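(* Let $\vartheta$ be a primitive random substitution whose RS-subshift $X_\vartheta$ is non-empty. Then the associated tiling space $\Omega_\vartheta$ is connected.
   Context: Let $\mathcal A=\{a_1,\dots,a_n\}$ be a finite alphabet, $\mathcal A^+$ the set of non-empty finite words over $\mathcal A$, and $\mathcal A^{\mathbb Z}$ the set of bi-infinite sequences with the product topology ($\mathcal A$ discrete). A random substitution (non-degenerate; the probabilities, all non-zero, play no role here and are suppressed) is a map $\vartheta$ assigning to each letter $a_i$ a non-empty finite set $\vartheta(a_i)\subset\mathcal A^+$ of realisations. A realisation of $\vartheta(u)$, for $u=u_1\cdots u_m\in\mathcal A^+$, is a word $x_1\cdots x_m$ with each $x_j\in\vartheta(u_j)$ chosen independently for each position. Realisations of $\vartheta^k(u)$ are defined inductively: $\vartheta^0$ is the identity, and the realisations of $\vartheta^{k+1}(u)$ are the realisations of $\vartheta(v)$ for $v$ a realisation of $\vartheta^k(u)$. $\vartheta$ is primitive if there is $k\in\mathbb N$ such that for all $1\le i,j\le n$ the letter $a_i$ is a subword of some realisation of $\vartheta^k(a_j)$. A word $u\in\mathcal A^+$ is $\vartheta$-legal if it is a subword of some realisation of $\vartheta^k(a_j)$ for some $k\in\mathbb N$ and some $j$. The RS-subshift is $X_\vartheta=\{w\in\mathcal A^{\mathbb Z}: \text{every finite non-empty subword of } w \text{ is } \vartheta\text{-legal}\}$, with the subspace topology and the shift $S(w)_i=w_{i+1}$. The tiling space is the quotient space $\Omega_\vartheta=X_\vartheta\times[0,1]/\!\sim$, where $\sim$ is the equivalence relation generated by $(x,1)\sim(Sx,0)$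 for $x\in X_\vartheta$. *)

theory Defs
  imports "HOL-Analysis.Analysis" "HOL-Library.Sublist"
begin

text \<open>
  The finite alphabet is a type of class \<open>finite\<close>, a finite word is a list over it, a subword is
  a contiguous sublist (\<^const>\<open>sublist\<close>), and a bi-infinite sequence is a function on \<open>int\<close>.
  A random substitution is represented by the sets of realisations of the letters.
\<close>

definition random_substitution :: "('a::finite \<Rightarrow> 'a list set) \<Rightarrow> bool" where
  "random_substitution \<theta> \<longleftrightarrow> (\<forall>a. finite (\<theta> a) \<and> \<theta> a \<noteq> {} \<and> [] \<notin> \<theta> a)"

definition realisations :: "('a \<Rightarrow> 'a list set) \<Rightarrow> 'a list \<Rightarrow> 'a list set" where
  "realisations \<theta> u = {concat xs | xs. list_all2 (\<lambda>x a. x \<in> \<theta> a) xs u}"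

primrec power_realisations :: "('a \<Rightarrow> 'a list set) \<Rightarrow> nat \<Rightarrow> 'a list \<Rightarrow> 'a list set" where
  "power_realisations \<theta> 0 u = {u}"
| "power_realisations \<theta> (Suc k) u = (\<Union>v \<in> power_realisations \<theta> k u. realisations \<theta> v)"

definition primitive_substitution :: "('a \<Rightarrow> 'a list set) \<Rightarrow> bool" where
  "primitive_substitution \<theta> \<longleftrightarrow>
     (\<exists>k. \<forall>a b. \<exists>w \<in> power_realisations \<theta> k [b]. sublist [a] w)"

definition legal :: "('a \<Rightarrow> 'a list set) \<Rightarrow> 'a list \<Rightarrow> bool" where
  "legal \<theta> u \<longleftrightarrow> u \<noteq> [] \<and> (\<exists>k a. \<exists>w \<in> power_realisations \<theta> k [a]. sublist u w)"

definition rs_subshift :: "('a \<Rightarrow> 'a list set) \<Rightarrow> (int \<Rightarrow> 'a) set" where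
  "rs_subshift \<theta> = {w. \<forall>i j. i \<le> j \<longrightarrow> legal \<theta> (map w [i..j])}"

definition rs_subshift_topology :: "('a \<Rightarrow> 'a list set) \<Rightarrow> (int \<Rightarrow> 'a) topology" where
  "rs_subshift_topology \<theta> =
     subtopology (product_topology (\<lambda>_. discrete_topology UNIV) UNIV) (rs_subshift \<theta>)"

definition shift :: "(int \<Rightarrow> 'a) \<Rightarrow> int \<Rightarrow> 'a" where
  "shift w = (\<lambda>i. w (i + 1))"

definition quotient_topology :: "'a topology \<Rightarrow> ('a \<times> 'a) set \<Rightarrow> 'a set topology" where
  "quotient_topology X R = topology (\<lambda>U. U \<subseteq> topspace X // R \<and>
     openin X {x \<in> topspace X. R `` {x} \<in> U})"

lemma openin_quotient_topology:
  "openin (quotient_topology X R) U \<longleftrightarrow>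
     U \<subseteq> topspace X // R \<and> openin X {x \<in> topspace X. R `` {x} \<in> U}"
proof -
  let ?P = "\<lambda>U. U \<subseteq> topspace X // R \<and> openin X {x \<in> topspace X. R `` {x} \<in> U}"
  have "istopology ?P"
    unfolding istopology_def
  proof (intro conjI allI impI)
    fix S T assume S: "?P S" and T: "?P T"
    have "{x \<in> topspace X. R `` {x} \<in> S \<inter> T}
        = {x \<in> topspace X. R `` {x} \<in> S} \<inter> {x \<in> topspace X. R `` {x} \<in> T}" by auto
    with S T show "openin X {x \<in> topspace X. R `` {x} \<in> S \<inter> T}" by auto
    from S show "S \<inter> T \<subseteq> topspace X // R" by auto
  next
    fix K assume K: "\<forall>U\<in>K. ?P U"
    have "{x \<in> topspace X. R `` {x} \<in> \<Union>K} = (\<Union>U\<in>K. {x \<in> topspace X. R `` {x} \<in> U})" by auto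
    with K show "openin X {x \<in> topspace X. R `` {x} \<in> \<Union>K}" by auto
    from K show "\<Union>K \<subseteq> topspace X // R" by auto
  qed
  then show ?thesis
    unfolding quotient_topology_def by (simp add: topology_inverse')
qed

lemma topspace_quotient_topology: "topspace (quotient_topology X R) = topspace X // R"
proof -
  have "{x \<in> topspace X. R `` {x} \<in> topspace X // R} = topspace X"
    by (auto intro: quotientI)
  then have "openin (quotient_topology X R) (topspace X // R)"
    by (simp add: openin_quotient_topology)
  then show ?thesis
    by (metis openin_quotient_topology openin_subset openin_topspace subset_antisym)
qed

lemma quotient_map_quotient_topology:
  "quotient_map X (quotient_topology X R) (\<lambda>x. R `` {x})"
  unfolding quotient_map_def topspace_quotient_topology openin_quotient_topology
  by (auto simp: quotient_def)

definition suspension_rel ::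
    "('a \<Rightarrow> 'a list set) \<Rightarrow> (((int \<Rightarrow> 'a) \<times> real) \<times> ((int \<Rightarrow> 'a) \<times> real)) set" where
  "suspension_rel \<theta> = {(p, q). p \<in> rs_subshift \<theta> \<times> {0..1} \<and> q \<in> rs_subshift \<theta> \<times> {0..1} \<and>
     equivclp (\<lambda>p q. \<exists>x \<in> rs_subshift \<theta>. p = (x, 1) \<and> q = (shift x, 0)) p q}"

lemma equiv_suspension_rel: "equiv (rs_subshift \<theta> \<times> {0..1}) (suspension_rel \<theta>)"
  unfolding suspension_rel_def
  by (auto intro!: equivI refl_onI symI transI dest: equivclp_sym equivclp_trans)

definition tiling_space :: "('a \<Rightarrow> 'a list set) \<Rightarrow> ((int \<Rightarrow> 'a) \<times> real) set topology" where
  "tiling_space \<theta> =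
     quotient_topology (prod_topology (rs_subshift_topology \<theta>) (top_of_set {0..1})) (suspension_rel \<theta>)"

end

theory Submission
  imports Defs
begin

text \<open>
  The substitution can be applied to a point of the subshift, with an independent choice of
  realisation at every position, and the result is again a point of the subshift. By
  primitivity, for large \<open>k\<close> every letter has a realisation of its \<open>k\<close>-th power containing a given
  legal word. So any two legal words occur together in some point of the subshift, and two
  non-empty open subsets of the subshift always meet a common shift orbit. In the suspension every
  shift orbit lies in a single connected component, hence no separation exists.
\<close>

section \<open>Realisations\<close>

lemma realisations_append:
  assumes "x \<in> realisations \<theta> u" "y \<in> realisations \<theta> v"
  shows "x @ y \<in> realisations \<theta> (u @ v)"
proof -
  obtain xs ys where "x = concat xs" "list_all2 (\<lambda>x a. x \<in> \<theta> a) xs u"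
    "y = concat ys" "list_all2 (\<lambda>x a. x \<in> \<theta> a) ys v"
    using assms unfolding realisations_def by auto
  then have "x @ y = concat (xs @ ys)" "list_all2 (\<lambda>x a. x \<in> \<theta> a) (xs @ ys) (u @ v)"
    by (auto intro: list_all2_appendI)
  then show ?thesis unfolding realisations_def by blast
qed

lemma power_realisations_append:
  assumes "x \<in> power_realisations \<theta> k u" "y \<in> power_realisations \<theta> k v"
  shows "x @ y \<in> power_realisations \<theta> k (u @ v)"
  using assms by (induction k arbitrary: x y) (auto, blast intro: realisations_append)

lemma power_realisations_Nil: "[] \<in> power_realisations \<theta> k []"
proof (induction k)
  case (Suc k)
  have "[] \<in> realisations \<theta> []" by (simp add: realisations_def)
  with Suc show ?case by auto
qed simp

text \<open>The choice \<open>f i\<close> belongs to the position \<open>i\<close>, not to the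
  letter \<open>z i\<close>, so equal letters may receive different realisations. This is the
  freedom with which two prescribed words are later planted in one point.\<close>

lemma power_realisations_concat_map:
  assumes "\<And>i. f i \<in> power_realisations \<theta> k [z i]"
  shows "concat (map f is) \<in> power_realisations \<theta> k (map z is)"
proof (induction "is")
  case Nil
  then show ?case by (simp add: power_realisations_Nil)
next
  case (Cons i "is")
  then show ?case using power_realisations_append[OF assms[of i] Cons] by simp
qed

lemma power_realisations_trans:
  assumes "v \<in> power_realisations \<theta> k u" "w \<in> power_realisations \<theta> l v"
  shows "w \<in> power_realisations \<theta> (k + l) u"
  using assms(2)
proof (induction l arbitrary: w)
  case 0
  then show ?case using assms(1) by simp
next
  case (Suc l)
  then show ?case by auto
qed

section \<open>Non-degeneracy, legal words and primitivity\<close>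

context
  fixes \<theta> :: "'a::finite \<Rightarrow> 'a list set"
  assumes random: "random_substitution \<theta>"
begin

lemma realisations_nonempty: "realisations \<theta> u \<noteq> {}"
proof -
  have "(SOME x. x \<in> \<theta> a) \<in> \<theta> a" for a
    using random unfolding random_substitution_def by (simp add: some_in_eq)
  then have "list_all2 (\<lambda>x a. x \<in> \<theta> a) (map (\<lambda>a. SOME x. x \<in> \<theta> a) u) u"
    by (simp add: list_all2_conv_all_nth)
  then show ?thesis unfolding realisations_def by blast
qed

lemma realisation_nonempty_word:
  assumes "w \<in> realisations \<theta> u" "u \<noteq> []"
  shows "w \<noteq> []"
proof -
  obtain xs where xs: "w = concat xs" "list_all2 (\<lambda>x a. x \<in> \<theta> a) xs u"
    using assms unfolding realisations_def by auto
  obtain a u' where "u = a # u'" using assms(2) by (cases u) auto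
  with xs obtain x xs' where "xs = x # xs'" "x \<in> \<theta> a" by (auto simp: list_all2_Cons2)
  then show ?thesis using xs random unfolding random_substitution_def by auto
qed

lemma power_realisations_nonempty: "power_realisations \<theta> k u \<noteq> {}"
  by (induction k) (use realisations_nonempty in auto)

lemma power_realisation_nonempty_word:
  assumes "w \<in> power_realisations \<theta> k u" "u \<noteq> []"
  shows "w \<noteq> []"
  using assms by (induction k arbitrary: w) (use realisation_nonempty_word in auto)

text \<open>The parts of \<open>v\<close> to the left and right of \<open>u\<close> always have some
  realisation, and these can be placed around \<open>w\<close>.\<close>

lemma power_realisations_sublist:
  assumes "sublist u v" "w \<in> power_realisations \<theta> k u"
  shows "\<exists>w' \<in> power_realisations \<theta> k v. sublist w w'"
proof -
  obtain l r where v: "v = l @ u @ r" using assms(1) unfolding sublist_def by auto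
  obtain l' r' where "l' \<in> power_realisations \<theta> k l" "r' \<in> power_realisations \<theta> k r"
    using power_realisations_nonempty by blast
  then have "l' @ w @ r' \<in> power_realisations \<theta> k v"
    unfolding v by (intro power_realisations_append assms)
  then show ?thesis by (metis sublist_appendI)
qed

text \<open>Some realisation \<open>t\<close> of a power of a letter contains \<open>u\<close>.
  Realising the rest of \<open>t\<close> as well embeds \<open>w\<close>, and with it
  \<open>v\<close>, in a realisation of a higher power of the same letter.\<close>

lemma legal_sublist_power_realisation:
  assumes "legal \<theta> u" "w \<in> power_realisations \<theta> k u" "sublist v w" "v \<noteq> []"
  shows "legal \<theta> v"
proof -
  obtain m a t where t: "t \<in> power_realisations \<theta> m [a]" "sublist u t"
    using assms(1) unfolding legal_def by auto
  obtain w' where "w' \<in> power_realisations \<theta> k t" "sublist w w'"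
    using power_realisations_sublist[OF t(2) assms(2)] by auto
  then have "w' \<in> power_realisations \<theta> (m + k) [a]" "sublist v w'"
    using power_realisations_trans[OF t(1)] assms(3) sublist_order.order_trans by auto
  then show ?thesis using assms(4) unfolding legal_def by blast
qed

text \<open>From any letter, \<open>k0\<close> steps can produce the letter \<open>a\<close>, and
  \<open>m\<close> further steps can turn \<open>a\<close> into a word containing \<open>u\<close>.
  The threshold \<open>K\<close> is the same for all letters \<open>c\<close>, and every exponent
  from \<open>K\<close> on works, so that two legal words can share one exponent.\<close>

lemma legal_in_large_powers:
  assumes "primitive_substitution \<theta>" "legal \<theta> u"
  obtains K where "\<And>k c. k \<ge> K \<Longrightarrow> \<exists>w \<in> power_realisations \<theta> k [c]. sublist u w"
proof -
  obtain k0 where k0: "\<And>a b. \<exists>w \<in> power_realisations \<theta> k0 [b]. sublist [a] w"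
    using assms(1) unfolding primitive_substitution_def by auto
  obtain m a t where t: "t \<in> power_realisations \<theta> m [a]" "sublist u t"
    using assms(2) unfolding legal_def by auto
  have "\<exists>w \<in> power_realisations \<theta> k [c]. sublist u w" if k: "k \<ge> k0 + m" for k c
  proof -
    \<comment> \<open>The surplus steps are spent first, on an arbitrary realisation of
      \<open>[c]\<close>. It is non-empty, and its first letter \<open>b\<close> then serves as the
      start for primitivity.\<close>
    define d where "d = k - (k0 + m)"
    obtain s where s: "s \<in> power_realisations \<theta> d [c]"
      using power_realisations_nonempty by blast
    then obtain b s' where b: "s = b # s'"
      using power_realisation_nonempty_word by (cases s) blast+
    obtain w where w: "w \<in> power_realisations \<theta> k0 [b]" "sublist [a] w" using k0 by blast
    have "sublist [b] s" unfolding b by simp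
    from power_realisations_sublist[OF this w(1)]
    obtain w' where w': "w' \<in> power_realisations \<theta> k0 s" "sublist w w'" by blast
    then have "sublist [a] w'" using w sublist_order.order_trans by blast
    from power_realisations_sublist[OF this t(1)]
    obtain w'' where w'': "w'' \<in> power_realisations \<theta> m w'" "sublist t w''" by blast
    have "w'' \<in> power_realisations \<theta> (d + k0 + m) [c]"
      using power_realisations_trans s w' w'' by blast
    moreover have "d + k0 + m = k" using k unfolding d_def by simp
    ultimately show ?thesis using w'' t(2) sublist_order.order_trans by metis
  qed
  then show ?thesis using that by blast
qed

end

section \<open>Bi-infinite concatenation\<close>

text \<open>The blocks \<open>f i\<close> are laid end to end, and \<open>p i\<close> is the left
  end of block \<open>i\<close>. As no block is empty, the half-open intervals from
  \<open>p i\<close> to \<open>p (i + 1)\<close> tile the integers, and each position reads its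
  letter from exactly one block.\<close>

lemma biinfinite_concat:
  fixes f :: "int \<Rightarrow> 'a list"
  assumes ne: "\<And>i. f i \<noteq> []"
  obtains x p where "\<And>n. \<exists>i. p i \<le> n \<and> n < p (i + 1)"
    and "\<And>i j. i \<le> j \<Longrightarrow> p i \<le> p j"
    and "\<And>i j. i \<le> j \<Longrightarrow> map x [p i..p j - 1] = concat (map f [i..j - 1])"
proof -
  \<comment> \<open>Signed partial sums of the block lengths: at most one of the two sums is
    non-empty, so \<open>p 0 = 0\<close>, and passing from \<open>i\<close> to \<open>i + 1\<close>
    adds \<open>length (f i)\<close> on both sides of 0.\<close>
  define p :: "int \<Rightarrow> int" where
    "p i = (\<Sum>k = 0..<i. int (length (f k))) - (\<Sum>k = i..<0. int (length (f k)))" for i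
  have p_succ: "p (i + 1) = p i + int (length (f i))" for i
  proof (cases "i \<ge> 0")
    case True
    then have "{0..<i + 1} = insert i {0..<i}" by auto
    then show ?thesis using True unfolding p_def by simp
  next
    case False
    then have "{i..<0} = insert i {i + 1..<0}" by auto
    then show ?thesis using False unfolding p_def by simp
  qed
  have pos: "length (f i) > 0" for i using ne by simp
  have mono: "p i \<le> p j" if "i \<le> j" for i j
    using that by (induction rule: int_ge_induct) (auto simp: p_succ)
  have cover: "\<exists>i. p i \<le> n \<and> n < p (i + 1)" for n
  proof (induction n rule: int_induct[where k = 0])
    case base
    have "p 0 = 0" unfolding p_def by simp
    then have "p 0 \<le> 0 \<and> 0 < p (0 + 1)" unfolding p_succ using pos[of 0] by simp
    then show ?case by blast
  next
    case (step1 n)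
    then obtain i where i: "p i \<le> n" "n < p (i + 1)" by blast
    have "p (i + 1) < p (i + 1 + 1)" using p_succ[of "i + 1"] pos[of "i + 1"] by linarith
    then have "p i \<le> n + 1 \<and> n + 1 < p (i + 1) \<or> p (i + 1) \<le> n + 1 \<and> n + 1 < p (i + 1 + 1)"
      using i by linarith
    then show ?case by blast
  next
    case (step2 n)
    then obtain i where i: "p i \<le> n" "n < p (i + 1)" by blast
    have "p (i - 1) < p i" using p_succ[of "i - 1"] pos[of "i - 1"] by simp
    then have "p i \<le> n - 1 \<and> n - 1 < p (i + 1) \<or>
        p (i - 1) \<le> n - 1 \<and> n - 1 < p (i - 1 + 1)"
      using i by (simp, linarith)
    then show ?case by blast
  qed
  \<comment> \<open>Together with \<open>cover\<close> this makes the \<open>THE\<close> in the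
    definition of \<open>x\<close> meaningful.\<close>
  have uniq: "i = j" if "p i \<le> n" "n < p (i + 1)" "p j \<le> n" "n < p (j + 1)" for i j n
    using that mono[of "i + 1" j] mono[of "j + 1" i] by linarith
  define x where "x n = (let i = THE i. p i \<le> n \<and> n < p (i + 1) in f i ! nat (n - p i))" for n
  have x: "x n = f i ! nat (n - p i)" if "p i \<le> n" "n < p (i + 1)" for n i
  proof -
    have "(THE i. p i \<le> n \<and> n < p (i + 1)) = i" using that uniq by blast
    then show ?thesis unfolding x_def by simp
  qed
  have block: "map x [p i..p (i + 1) - 1] = f i" for i
  proof (rule nth_equalityI)
    fix n assume "n < length (map x [p i..p (i + 1) - 1])"
    then have "n < length (f i)" by (simp add: p_succ)
    then show "map x [p i..p (i + 1) - 1] ! n = f i ! n"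
      using x[of i "p i + int n"] by (simp add: p_succ)
  qed (simp add: p_succ)
  have "map x [p i..p j - 1] = concat (map f [i..j - 1])" if "i \<le> j" for i j
    using that
  proof (induction rule: int_ge_induct)
    case base
    then show ?case by simp
  next
    case (step j)
    have "[p i..p (j + 1) - 1] = [p i..p j - 1] @ [p j..p (j + 1) - 1]"
      using mono[OF step.hyps] p_succ[of j] pos[of j] by (intro upto_split1) linarith+
    moreover have "[i..j + 1 - 1] = [i..j - 1] @ [j]"
      using step.hyps by (simp add: upto_rec2)
    ultimately show ?case using step.IH block by simp
  qed
  with cover mono show ?thesis using that by blast
qed

lemma sublist_map_upto_occurrence:
  assumes "sublist u (map x [a..b])"
  obtains c where "map x [c..c + int (length u) - 1] = u"
proof -
  obtain l r where eq: "map x [a..b] = l @ u @ r" using assms unfolding sublist_def by auto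
  have len: "length l + length u + length r = nat (b - a + 1)"
    using arg_cong[OF eq, of length] by simp
  have "map x [a + int (length l)..a + int (length l) + int (length u) - 1] = u"
  proof (rule nth_equalityI)
    fix n
    assume "n < length (map x [a + int (length l)..a + int (length l) + int (length u) - 1])"
    then have n: "n < length u" by simp
    have "(l @ u @ r) ! (length l + n) = x (a + int (length l + n))"
      unfolding eq[symmetric] using n len by simp
    then show "map x [a + int (length l)..a + int (length l) + int (length u) - 1] ! n = u ! n"
      using n by (simp add: nth_append add.assoc)
  qed simp
  then show ?thesis using that by blast
qed

section \<open>Topological transitivity of the subshift\<close>

lemma sublist_map_upto:
  assumes "a \<le> i" "i \<le> j" "j \<le> b"
  shows "sublist (map x [i..j]) (map x [a..b])"
proof -
  have "[a..b] = [a..i - 1] @ [i..j] @ [j + 1..b]"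
    using assms by (metis upto_split1 upto_split2 order_trans)
  then show ?thesis by (metis map_append sublist_appendI)
qed

text \<open>The \<open>k\<close>-th power of \<theta> is applied to a point \<open>z\<close>, with a
  realisation containing \<open>u\<close> chosen at position 0 and realisations containing
  \<open>v\<close> at all others. Every window of the result lies in a realisation of a window of
  \<open>z\<close>, hence is legal.\<close>

lemma rs_subshift_contains_legal_pair:
  assumes random: "random_substitution \<theta>" and primitive: "primitive_substitution \<theta>"
    and ne: "rs_subshift \<theta> \<noteq> {}" and u: "legal \<theta> u" and v: "legal \<theta> v"
  obtains x c d where "x \<in> rs_subshift \<theta>"
    and "map x [c..c + int (length u) - 1] = u" and "map x [d..d + int (length v) - 1] = v"
proof -
  obtain z where z: "z \<in> rs_subshift \<theta>" using ne by blast
  obtain K where K: "\<And>k c. k \<ge> K \<Longrightarrow> \<exists>w \<in> power_realisations \<theta> k [c]. sublist u w"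
    using legal_in_large_powers[OF random primitive u] by blast
  obtain L where L: "\<And>k c. k \<ge> L \<Longrightarrow> \<exists>w \<in> power_realisations \<theta> k [c]. sublist v w"
    using legal_in_large_powers[OF random primitive v] by blast
  \<comment> \<open>All positions must use the same power, hence a common exponent for
    \<open>u\<close> and \<open>v\<close>.\<close>
  define k where "k = max K L"
  have "\<exists>w. w \<in> power_realisations \<theta> k [z i] \<and> (if i = 0 then sublist u w else sublist v w)" for i
    using K[of k "z i"] L[of k "z i"] unfolding k_def by auto
  then obtain f where f: "\<And>i. f i \<in> power_realisations \<theta> k [z i]"
    and fuv: "\<And>i. if i = 0 then sublist u (f i) else sublist v (f i)" by metis
  have "f i \<noteq> []" for i using power_realisation_nonempty_word[OF random f] by blast
  from biinfinite_concat[of f, OF this] obtain x p where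
    cover: "\<And>n. \<exists>i. p i \<le> n \<and> n < p (i + 1)" and
    mono: "\<And>i j. i \<le> j \<Longrightarrow> p i \<le> p j" and
    blocks: "\<And>i j. i \<le> j \<Longrightarrow> map x [p i..p j - 1] = concat (map f [i..j - 1])"
    by metis
  have "legal \<theta> (map x [i..j])" if "i \<le> j" for i j
  proof -
    obtain a b where a: "p a \<le> i" and b: "p b \<le> j" "j < p (b + 1)" using cover by metis
    \<comment> \<open>The maximum gives \<open>a \<le> b'\<close> directly, so the window
      \<open>[a..b']\<close> of \<open>z\<close> is non-empty and its word is legal.\<close>
    define b' where "b' = max a b"
    have b': "a \<le> b'" "j < p (b' + 1)"
      using b mono[of "b + 1" "b' + 1"] unfolding b'_def by auto
    have "sublist (map x [i..j]) (map x [p a..p (b' + 1) - 1])"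
      using a b' that by (intro sublist_map_upto) auto
    also have "map x [p a..p (b' + 1) - 1] = concat (map f [a..b'])"
      using blocks[of a "b' + 1"] b' by simp
    finally have "sublist (map x [i..j]) (concat (map f [a..b']))" .
    moreover have "legal \<theta> (map z [a..b'])" using z b'(1) unfolding rs_subshift_def by blast
    ultimately show ?thesis
      using legal_sublist_power_realisation[OF random _ power_realisations_concat_map[of f, OF f]]
        that by simp
  qed
  then have "x \<in> rs_subshift \<theta>" unfolding rs_subshift_def by blast
  \<comment> \<open>Blocks 0 and 1 supply the occurrences of \<open>u\<close> and
    \<open>v\<close>.\<close>
  moreover have "sublist u (map x [p 0..p 1 - 1])" using blocks[of 0 1] fuv[of 0] by simp
  moreover have "sublist v (map x [p 1..p 2 - 1])" using blocks[of 1 2] fuv[of 1] by simp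
  ultimately show ?thesis using that by (metis sublist_map_upto_occurrence)
qed

section \<open>Translates, cylinder neighbourhoods and common orbits\<close>

lemma rs_subshift_translate:
  assumes "x \<in> rs_subshift \<theta>"
  shows "(\<lambda>i. x (i + m)) \<in> rs_subshift \<theta>"
proof -
  have "map (\<lambda>i. x (i + m)) [i..j] = map x [i + m..j + m]" for i j
    by (rule nth_equalityI) (auto simp: add_ac)
  then show ?thesis using assms unfolding rs_subshift_def by simp
qed

lemma topspace_rs_subshift_topology: "topspace (rs_subshift_topology \<theta>) = rs_subshift \<theta>"
  unfolding rs_subshift_topology_def by simp

text \<open>A basic open set of the product topology restricts only finitely many coordinates, and
  these fit into a symmetric window around 0.\<close>

lemma openin_rs_subshift_window:
  assumes "openin (rs_subshift_topology \<theta>) U" "x \<in> U"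
  obtains N :: int where "N \<ge> 0"
    and "\<And>y. y \<in> rs_subshift \<theta> \<Longrightarrow> (\<And>i. \<bar>i\<bar> \<le> N \<Longrightarrow> y i = x i) \<Longrightarrow> y \<in> U"
proof -
  obtain W where W: "openin (product_topology (\<lambda>_. discrete_topology UNIV) UNIV) W"
    "U = W \<inter> rs_subshift \<theta>"
    using assms(1) unfolding rs_subshift_topology_def openin_subtopology by blast
  then obtain V where V: "finite {i. V i \<noteq> UNIV}" "x \<in> Pi\<^sub>E UNIV V" "Pi\<^sub>E UNIV V \<subseteq> W"
    using assms(2) unfolding openin_product_topology_alt by fastforce
  obtain N where N: "\<And>i. V i \<noteq> UNIV \<Longrightarrow> \<bar>i\<bar> \<le> N" "N \<ge> 0"
  proof
    \<comment> \<open>Inserting 0 keeps the maximum defined when no coordinate is restricted, and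
      makes it non-negative.\<close>
    show "\<bar>i\<bar> \<le> Max (insert 0 (abs ` {i. V i \<noteq> UNIV}))" if "V i \<noteq> UNIV" for i
      using V(1) that by (intro Max_ge) auto
    show "Max (insert 0 (abs ` {i. V i \<noteq> UNIV})) \<ge> 0"
      using V(1) by (intro Max_ge) auto
  qed
  have "y \<in> U" if y: "y \<in> rs_subshift \<theta>" "\<And>i. \<bar>i\<bar> \<le> N \<Longrightarrow> y i = x i" for y
  proof -
    have "y i \<in> V i" for i
      using V(2) N(1)[of i] y(2)[of i] by (cases "V i = UNIV") (auto simp: PiE_iff)
    then show ?thesis using V(3) W(2) y(1) by (auto simp: PiE_iff)
  qed
  with N(2) show ?thesis using that by blast
qed

text \<open>Each open set contains all points agreeing with a chosen one on a central window. The
  two window words are legal, so both occur in a single point \<open>x\<close>; translating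
  \<open>x\<close> centres either occurrence at 0.\<close>

lemma rs_subshift_transitive:
  assumes "random_substitution \<theta>" "primitive_substitution \<theta>"
    and U: "openin (rs_subshift_topology \<theta>) U" "U \<noteq> {}"
    and V: "openin (rs_subshift_topology \<theta>) V" "V \<noteq> {}"
  obtains x m n where "x \<in> rs_subshift \<theta>" "(\<lambda>i. x (i + m)) \<in> U" "(\<lambda>i. x (i + n)) \<in> V"
proof -
  obtain y z where y: "y \<in> U" and z: "z \<in> V" using U V by blast
  then have yz: "y \<in> rs_subshift \<theta>" "z \<in> rs_subshift \<theta>"
    using U V openin_subset topspace_rs_subshift_topology by blast+
  obtain M where M: "M \<ge> 0"
    "\<And>w. w \<in> rs_subshift \<theta> \<Longrightarrow> (\<And>i. \<bar>i\<bar> \<le> M \<Longrightarrow> w i = y i) \<Longrightarrow> w \<in> U"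
    using openin_rs_subshift_window[OF U(1) y] by blast
  obtain N where N: "N \<ge> 0"
    "\<And>w. w \<in> rs_subshift \<theta> \<Longrightarrow> (\<And>i. \<bar>i\<bar> \<le> N \<Longrightarrow> w i = z i) \<Longrightarrow> w \<in> V"
    using openin_rs_subshift_window[OF V(1) z] by blast
  have legal: "legal \<theta> (map y [-M..M])" "legal \<theta> (map z [-N..N])"
    using yz M(1) N(1) unfolding rs_subshift_def by auto
  obtain x c d where x: "x \<in> rs_subshift \<theta>"
    and c: "map x [c..c + int (length (map y [-M..M])) - 1] = map y [-M..M]"
    and d: "map x [d..d + int (length (map z [-N..N])) - 1] = map z [-N..N]"
    using rs_subshift_contains_legal_pair[OF assms(1,2) _ legal] yz(1) by blast
  \<comment> \<open>An occurrence starting at \<open>e\<close> has its centre at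
    \<open>e + K\<close>, as the window word starts at coordinate \<open>-K\<close>.\<close>
  have centre: "w (i + (e + K)) = v i"
    if "map w [e..e + int (length (map v [-K..K])) - 1] = map v [-K..K]" "\<bar>i\<bar> \<le> K"
    for w v :: "int \<Rightarrow> 'a" and e K i
    using arg_cong[OF that(1), of "\<lambda>l. l ! nat (i + K)"] that(2)
    by (simp add: add_ac abs_le_iff)
  have "(\<lambda>i. x (i + (c + M))) \<in> U"
    using M(2) rs_subshift_translate[OF x] centre[OF c] by blast
  moreover have "(\<lambda>i. x (i + (d + N))) \<in> V"
    using N(2) rs_subshift_translate[OF x] centre[OF d] by blast
  ultimately show ?thesis using that x by blast
qed

section \<open>The tiling space\<close>

context
  fixes \<theta> :: "'a::finite \<Rightarrow> 'a list set"
begin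

private abbreviation point :: "(int \<Rightarrow> 'a) \<Rightarrow> real \<Rightarrow> ((int \<Rightarrow> 'a) \<times> real) set" where
  "point x t \<equiv> suspension_rel \<theta> `` {(x, t)}"

lemma continuous_map_point:
  "continuous_map (prod_topology (rs_subshift_topology \<theta>) (top_of_set {0..1})) (tiling_space \<theta>)
     (\<lambda>p. suspension_rel \<theta> `` {p})"
  unfolding tiling_space_def
  by (rule quotient_imp_continuous_map[OF quotient_map_quotient_topology])

text \<open>The fibre over \<open>x\<close> is a continuous image of the unit interval, hence a
  connected set containing both points.\<close>

lemma connected_component_fibre:
  assumes "x \<in> rs_subshift \<theta>" "s \<in> {0..1}" "t \<in> {0..1}"
  shows "connected_component_of (tiling_space \<theta>) (point x s) (point x t)"
proof -
  have "continuous_map (top_of_set {0..1})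
      (prod_topology (rs_subshift_topology \<theta>) (top_of_set {0..1})) (\<lambda>t::real. (x, t))"
    using assms(1) by (simp add: continuous_map_paired topspace_rs_subshift_topology)
  then have "continuous_map (top_of_set {0..1}) (tiling_space \<theta>)
      ((\<lambda>p. suspension_rel \<theta> `` {p}) \<circ> (\<lambda>t. (x, t)))"
    using continuous_map_point continuous_map_compose by blast
  then have "connectedin (tiling_space \<theta>)
      (((\<lambda>p. suspension_rel \<theta> `` {p}) \<circ> (\<lambda>t. (x, t))) ` {0..1})"
    by (rule connectedin_continuous_map_image) (simp add: connectedin_subtopology)
  then show ?thesis unfolding connected_component_of_def using assms by force
qed

lemma point_1_eq_shift:
  assumes "x \<in> rs_subshift \<theta>"
  shows "point x 1 = point (shift x) 0"
proof (rule equiv_class_eq[OF equiv_suspension_rel])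
  have "shift x \<in> rs_subshift \<theta>"
    unfolding shift_def by (rule rs_subshift_translate[OF assms])
  then show "((x, 1), (shift x, 0)) \<in> suspension_rel \<theta>"
    using assms unfolding suspension_rel_def by (auto intro: r_into_equivclp)
qed

text \<open>Climbing a fibre from level 0 to level 1 ends at a point glued to the base of the fibre
  over the shifted sequence. Repeating this, upwards or downwards, reaches every translate.\<close>

lemma connected_component_translate:
  assumes x: "x \<in> rs_subshift \<theta>"
  shows "connected_component_of (tiling_space \<theta>) (point x 0) (point (\<lambda>i. x (i + m)) 0)"
proof -
  have step: "connected_component_of (tiling_space \<theta>)
      (point (\<lambda>i. x (i + m)) 0) (point (\<lambda>i. x (i + (m + 1))) 0)" for m
    using connected_component_fibre[OF rs_subshift_translate[OF x, of m], of 0 1]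
      point_1_eq_shift[OF rs_subshift_translate[OF x, of m]]
    by (simp add: shift_def add_ac)
  show ?thesis
  proof (induction m rule: int_induct[where k = 0])
    case base
    then show ?case using connected_component_fibre[OF x, of 0 0] by simp
  next
    case (step1 m)
    show ?case by (rule connected_component_of_trans[OF step1(2) step])
  next
    case (step2 m)
    have "connected_component_of (tiling_space \<theta>)
        (point (\<lambda>i. x (i + m)) 0) (point (\<lambda>i. x (i + (m - 1))) 0)"
      using step[of "m - 1"] by (simp add: connected_component_of_sym)
    then show ?case by (rule connected_component_of_trans[OF step2(2)])
  qed
qed

section \<open>Open sets of the tiling space seen on the base\<close>

lemma openin_base_points:
  assumes "openin (tiling_space \<theta>) E"
  shows "openin (rs_subshift_topology \<theta>) {x \<in> rs_subshift \<theta>. point x 0 \<in> E}"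
proof -
  have "continuous_map (rs_subshift_topology \<theta>)
      (prod_topology (rs_subshift_topology \<theta>) (top_of_set {0..1})) (\<lambda>x. (x, 0::real))"
    by (simp add: continuous_map_paired)
  then have "continuous_map (rs_subshift_topology \<theta>) (tiling_space \<theta>)
      ((\<lambda>p. suspension_rel \<theta> `` {p}) \<circ> (\<lambda>x. (x, 0)))"
    using continuous_map_point continuous_map_compose by blast
  from openin_continuous_map_preimage[OF this assms] show ?thesis
    by (simp add: topspace_rs_subshift_topology)
qed

text \<open>A point of \<open>E\<close> has a representative at some level \<open>t\<close>. Sliding
  it along its fibre to level 0 stays in one connected component, hence in \<open>E\<close>.\<close>

lemma base_points_nonempty:
  assumes "openin (tiling_space \<theta>) E" "E \<noteq> {}"
    and closed: "\<And>a b. connected_component_of (tiling_space \<theta>) a b \<Longrightarrow> a \<in> E \<Longrightarrow> b \<in> E"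
  shows "{x \<in> rs_subshift \<theta>. point x 0 \<in> E} \<noteq> {}"
proof -
  obtain e where e: "e \<in> E" using assms(2) by blast
  then have "e \<in> (rs_subshift \<theta> \<times> {0..1}) // suspension_rel \<theta>"
    using openin_subset[OF assms(1)]
    by (auto simp: tiling_space_def topspace_quotient_topology topspace_rs_subshift_topology)
  then obtain x t where "x \<in> rs_subshift \<theta>" "t \<in> {0..1}" "e = point x t"
    by (auto elim!: quotientE)
  then show ?thesis using connected_component_fibre[of x t 0] closed e by auto
qed

end

theorem corollary21:
  fixes \<theta> :: "'a::finite \<Rightarrow> 'a list set"
  assumes "random_substitution \<theta>"
    and "primitive_substitution \<theta>"
    and "rs_subshift \<theta> \<noteq> {}"
  shows "connected_space (tiling_space \<theta>)"
  unfolding connected_space_def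
proof (intro notI, elim exE conjE)
  fix E F
  assume E: "openin (tiling_space \<theta>) E" and F: "openin (tiling_space \<theta>) F"
    and cover: "topspace (tiling_space \<theta>) \<subseteq> E \<union> F" and disjoint: "E \<inter> F = {}"
    and ne: "E \<noteq> {}" "F \<noteq> {}"
  \<comment> \<open>A connected set cannot meet both halves of a separation, so each half is a union
    of connected components.\<close>
  have same_side: "(a \<in> E \<longleftrightarrow> b \<in> E) \<and> (a \<in> F \<longleftrightarrow> b \<in> F)"
    if ab: "connected_component_of (tiling_space \<theta>) a b" for a b
  proof -
    obtain C where C: "connectedin (tiling_space \<theta>) C" "a \<in> C" "b \<in> C"
      using ab unfolding connected_component_of_def by blast
    then have "C \<subseteq> E \<union> F" using cover connectedin_subset_topspace by blast
    moreover have "\<not> (C \<subseteq> E \<union> F \<and> E \<inter> F \<inter> C = {} \<and> E \<inter> C \<noteq> {} \<and> F \<inter> C \<noteq> {})"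
      using C(1) E F unfolding connectedin by blast
    ultimately show ?thesis using C disjoint by blast
  qed
  let ?A = "\<lambda>E. {x \<in> rs_subshift \<theta>. suspension_rel \<theta> `` {(x, 0)} \<in> E}"
  have ne': "?A E \<noteq> {}" "?A F \<noteq> {}"
    using base_points_nonempty[OF E ne(1)] base_points_nonempty[OF F ne(2)] same_side by blast+
  \<comment> \<open>The base traces of \<open>E\<close> and \<open>F\<close> are non-empty and open,
    so one orbit visits both. All base points of that orbit share a component, which would have to
    lie in \<open>E\<close> and in \<open>F\<close>.\<close>
  obtain x m n where x: "x \<in> rs_subshift \<theta>"
    "(\<lambda>i. x (i + m)) \<in> ?A E" "(\<lambda>i. x (i + n)) \<in> ?A F"
    by (rule rs_subshift_transitive[OF assms(1,2) openin_base_points[OF E] ne'(1)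
          openin_base_points[OF F] ne'(2)])
  then have "suspension_rel \<theta> `` {(x, 0)} \<in> E" "suspension_rel \<theta> `` {(x, 0)} \<in> F"
    using same_side[OF connected_component_translate[OF x(1), of m]]
      same_side[OF connected_component_translate[OF x(1), of n]] by auto
  then show False using disjoint by blast
qed

end
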